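(* (Hilbert's Theorem 90 for Lie algebras) Let $k$ be a field and let $G$ be a finite cyclic group generated by an element $\gamma$ whose order $n$ is invertible in $k$. Let $\mathfrak{h}$ be a Lie algebra over $k$, $\varphi:G\to\mathrm{Aut}_{\mathrm{Lie}}(\mathfrak{h})$ a morphism of groups, and $t:\mathfrak{h}\to\mathfrak{h}^G$ the trace map. Then $$\ker(t)=\{\,y-\gamma\triangleright y\mid y\in\mathfrak{h}\,\}.$$
   Context: Notation: $g\triangleright x:=\varphi(g)(x)$ for $g\in G$, $x\in\mathfrak{h}$. The subalgebra of invariants is $\mathfrak{h}^G:=\{x\in\mathfrak{h}\mid g\triangleright x=x\ \forall g\in G\}$. The trace map (Reynolds operator) is the linear map $t:\mathfrak{h}\to\mathfrak{h}^G$, $t(x):=|G|^{-1}\sum_{g\in G}g\triangleright x$. *)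

theory Defs
  imports "HOL-Algebra.Algebra"
begin

text \<open>
  As everywhere in \<open>HOL-Algebra\<close>, the record inherited from \<^typ>\<open>('a, 'b) module\<close> also has
  the ring fields for multiplication and unit; no axiom below constrains them.
\<close>

record ('a, 'b) lie_algebra = "('a, 'b) module" +
  bracket :: "'b \<Rightarrow> 'b \<Rightarrow> 'b"  (\<open>(\<open>notation=\<open>mixfix bracket\<close>\<close>\<lbrakk>_, _\<rbrakk>\<index>)\<close>)

locale lie_algebra = module K L
  for K :: "('a, 'm) ring_scheme" (structure) and L :: "('a, 'b, 'n) lie_algebra_scheme" (structure) +
  assumes bracket_closed [simp, intro]:
      "\<lbrakk> x \<in> carrier L; y \<in> carrier L \<rbrakk> \<Longrightarrow> \<lbrakk>x, y\<rbrakk>\<^bsub>L\<^esub> \<in> carrier L"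
    and bracket_add_left:
      "\<lbrakk> x \<in> carrier L; y \<in> carrier L; z \<in> carrier L \<rbrakk> \<Longrightarrow>
        \<lbrakk>x \<oplus>\<^bsub>L\<^esub> y, z\<rbrakk>\<^bsub>L\<^esub> = \<lbrakk>x, z\<rbrakk>\<^bsub>L\<^esub> \<oplus>\<^bsub>L\<^esub> \<lbrakk>y, z\<rbrakk>\<^bsub>L\<^esub>"
    and bracket_add_right:
      "\<lbrakk> x \<in> carrier L; y \<in> carrier L; z \<in> carrier L \<rbrakk> \<Longrightarrow>
        \<lbrakk>x, y \<oplus>\<^bsub>L\<^esub> z\<rbrakk>\<^bsub>L\<^esub> = \<lbrakk>x, y\<rbrakk>\<^bsub>L\<^esub> \<oplus>\<^bsub>L\<^esub> \<lbrakk>x, z\<rbrakk>\<^bsub>L\<^esub>"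
    and bracket_smult_left:
      "\<lbrakk> a \<in> carrier K; x \<in> carrier L; y \<in> carrier L \<rbrakk> \<Longrightarrow>
        \<lbrakk>a \<odot>\<^bsub>L\<^esub> x, y\<rbrakk>\<^bsub>L\<^esub> = a \<odot>\<^bsub>L\<^esub> \<lbrakk>x, y\<rbrakk>\<^bsub>L\<^esub>"
    and bracket_smult_right:
      "\<lbrakk> a \<in> carrier K; x \<in> carrier L; y \<in> carrier L \<rbrakk> \<Longrightarrow>
        \<lbrakk>x, a \<odot>\<^bsub>L\<^esub> y\<rbrakk>\<^bsub>L\<^esub> = a \<odot>\<^bsub>L\<^esub> \<lbrakk>x, y\<rbrakk>\<^bsub>L\<^esub>"
    and bracket_self: "x \<in> carrier L \<Longrightarrow> \<lbrakk>x, x\<rbrakk>\<^bsub>L\<^esub> = \<zero>\<^bsub>L\<^esub>"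
    and jacobi:
      "\<lbrakk> x \<in> carrier L; y \<in> carrier L; z \<in> carrier L \<rbrakk> \<Longrightarrow>
        \<lbrakk>x, \<lbrakk>y, z\<rbrakk>\<^bsub>L\<^esub>\<rbrakk>\<^bsub>L\<^esub> \<oplus>\<^bsub>L\<^esub> \<lbrakk>y, \<lbrakk>z, x\<rbrakk>\<^bsub>L\<^esub>\<rbrakk>\<^bsub>L\<^esub> \<oplus>\<^bsub>L\<^esub> \<lbrakk>z, \<lbrakk>x, y\<rbrakk>\<^bsub>L\<^esub>\<rbrakk>\<^bsub>L\<^esub> = \<zero>\<^bsub>L\<^esub>"

definition lie_hom ::
  "('a, 'm) ring_scheme \<Rightarrow> ('a, 'b, 'n) lie_algebra_scheme \<Rightarrow> ('a, 'c, 'p) lie_algebra_scheme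
    \<Rightarrow> ('b \<Rightarrow> 'c) set"
  where "lie_hom K L M =
    {f \<in> hom (add_monoid L) (add_monoid M).
      (\<forall>a\<in>carrier K. \<forall>x\<in>carrier L. f (a \<odot>\<^bsub>L\<^esub> x) = a \<odot>\<^bsub>M\<^esub> f x) \<and>
      (\<forall>x\<in>carrier L. \<forall>y\<in>carrier L. f \<lbrakk>x, y\<rbrakk>\<^bsub>L\<^esub> = \<lbrakk>f x, f y\<rbrakk>\<^bsub>M\<^esub>)}"

text \<open>
  As for \<^const>\<open>AutoGroup\<close>, automorphisms are represented by functions that are
  \<^const>\<open>undefined\<close> off the carrier, and the product is composition.
\<close>

definition lie_auto ::
  "('a, 'm) ring_scheme \<Rightarrow> ('a, 'b, 'n) lie_algebra_scheme \<Rightarrow> ('b \<Rightarrow> 'b) set"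
  where "lie_auto K L = lie_hom K L L \<inter> Bij (carrier L)"

definition LieAutGroup ::
  "('a, 'm) ring_scheme \<Rightarrow> ('a, 'b, 'n) lie_algebra_scheme \<Rightarrow> ('b \<Rightarrow> 'b) monoid"
  where "LieAutGroup K L = BijGroup (carrier L) \<lparr>carrier := lie_auto K L\<rparr>"

definition lie_invariants ::
  "('a, 'b, 'n) lie_algebra_scheme \<Rightarrow> ('g, 'p) monoid_scheme \<Rightarrow> ('g \<Rightarrow> 'b \<Rightarrow> 'b)
    \<Rightarrow> ('a, 'b, 'n) lie_algebra_scheme"
  where "lie_invariants L G \<phi> =
    L \<lparr>carrier := {x \<in> carrier L. \<forall>g\<in>carrier G. \<phi> g x = x}\<rparr>"

text \<open>
  The scalar is the inverse in \<open>K\<close> of the image of the group order, so the definition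
  is only meaningful when that image is a unit.
\<close>

definition lie_trace ::
  "('a, 'm) ring_scheme \<Rightarrow> ('a, 'b, 'n) lie_algebra_scheme \<Rightarrow> ('g, 'p) monoid_scheme
    \<Rightarrow> ('g \<Rightarrow> 'b \<Rightarrow> 'b) \<Rightarrow> 'b \<Rightarrow> 'b"
  where "lie_trace K L G \<phi> =
    (\<lambda>x\<in>carrier L. inv\<^bsub>K\<^esub> ([order G] \<cdot>\<^bsub>K\<^esub> \<one>\<^bsub>K\<^esub>) \<odot>\<^bsub>L\<^esub> (\<Oplus>\<^bsub>L\<^esub>g\<in>carrier G. \<phi> g x))"

lemma lie_homD:
  assumes "f \<in> lie_hom K L M"
  shows "\<And>x. x \<in> carrier L \<Longrightarrow> f x \<in> carrier M"
    and "\<And>x y. x \<in> carrier L \<Longrightarrow> y \<in> carrier L \<Longrightarrow> f (x \<oplus>\<^bsub>L\<^esub> y) = f x \<oplus>\<^bsub>M\<^esub> f y"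
    and "\<And>a x. a \<in> carrier K \<Longrightarrow> x \<in> carrier L \<Longrightarrow> f (a \<odot>\<^bsub>L\<^esub> x) = a \<odot>\<^bsub>M\<^esub> f x"
    and "\<And>x y. x \<in> carrier L \<Longrightarrow> y \<in> carrier L \<Longrightarrow> f \<lbrakk>x, y\<rbrakk>\<^bsub>L\<^esub> = \<lbrakk>f x, f y\<rbrakk>\<^bsub>M\<^esub>"
  using assms by (auto simp: lie_hom_def hom_def)

lemma lie_homI:
  assumes "\<And>x. x \<in> carrier L \<Longrightarrow> f x \<in> carrier M"
    and "\<And>x y. x \<in> carrier L \<Longrightarrow> y \<in> carrier L \<Longrightarrow> f (x \<oplus>\<^bsub>L\<^esub> y) = f x \<oplus>\<^bsub>M\<^esub> f y"
    and "\<And>a x. a \<in> carrier K \<Longrightarrow> x \<in> carrier L \<Longrightarrow> f (a \<odot>\<^bsub>L\<^esub> x) = a \<odot>\<^bsub>M\<^esub> f x"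
    and "\<And>x y. x \<in> carrier L \<Longrightarrow> y \<in> carrier L \<Longrightarrow> f \<lbrakk>x, y\<rbrakk>\<^bsub>L\<^esub> = \<lbrakk>f x, f y\<rbrakk>\<^bsub>M\<^esub>"
  shows "f \<in> lie_hom K L M"
  using assms by (auto simp: lie_hom_def hom_def)

context lie_algebra
begin

lemma subgroup_lie_auto: "subgroup (lie_auto K L) (BijGroup (carrier L))"
proof (rule subgroup.intro)
  show "lie_auto K L \<subseteq> carrier (BijGroup (carrier L))"
    by (auto simp: lie_auto_def BijGroup_def)
next
  fix f g assume fg: "f \<in> lie_auto K L" "g \<in> lie_auto K L"
  then have B: "f \<in> Bij (carrier L)" "g \<in> Bij (carrier L)"
    and H: "f \<in> lie_hom K L L" "g \<in> lie_hom K L L"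
    by (auto simp: lie_auto_def)
  have "compose (carrier L) f g \<in> lie_hom K L L"
    by (rule lie_homI) (simp_all add: compose_eq lie_homD[OF H(1)] lie_homD[OF H(2)])
  then show "f \<otimes>\<^bsub>BijGroup (carrier L)\<^esub> g \<in> lie_auto K L"
    using B by (simp add: BijGroup_def lie_auto_def compose_Bij)
next
  have "(\<lambda>x\<in>carrier L. x) \<in> lie_hom K L L"
    by (rule lie_homI) simp_all
  then show "\<one>\<^bsub>BijGroup (carrier L)\<^esub> \<in> lie_auto K L"
    by (simp add: BijGroup_def lie_auto_def id_Bij)
next
  fix f assume "f \<in> lie_auto K L"
  then have B: "f \<in> Bij (carrier L)" and H: "f \<in> lie_hom K L L"
    by (auto simp: lie_auto_def)
  let ?i = "inv_into (carrier L) f"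
  have bij: "bij_betw f (carrier L) (carrier L)"
    using B by (simp add: Bij_def)
  have cl: "?i x \<in> carrier L" and fi: "f (?i x) = x" if "x \<in> carrier L" for x
    using that bij by (auto simp: bij_betw_def intro: inv_into_into f_inv_into_f)
  have eq: "?i x = y" if "y \<in> carrier L" "f y = x" for x y
    using that bij by (auto simp: bij_betw_def)
  have "restrict ?i (carrier L) \<in> lie_hom K L L"
    by (rule lie_homI) (auto simp: cl fi lie_homD[OF H] intro!: eq)
  then show "inv\<^bsub>BijGroup (carrier L)\<^esub> f \<in> lie_auto K L"
    using B by (simp del: restrict_apply add: inv_BijGroup lie_auto_def restrict_inv_into_Bij)
qed

theorem group_LieAutGroup: "group (LieAutGroup K L)"
  unfolding LieAutGroup_def
  by (rule subgroup.subgroup_is_group[OF subgroup_lie_auto group_BijGroup])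

lemma lie_action:
  assumes "\<phi> \<in> hom G (LieAutGroup K L)" and "g \<in> carrier G"
  shows "\<phi> g \<in> lie_hom K L L" and "\<phi> g \<in> Bij (carrier L)"
    and "\<And>h x. h \<in> carrier G \<Longrightarrow> x \<in> carrier L \<Longrightarrow> \<phi> (g \<otimes>\<^bsub>G\<^esub> h) x = \<phi> g (\<phi> h x)"
proof -
  have *: "\<phi> h \<in> lie_hom K L L \<and> \<phi> h \<in> Bij (carrier L)" if "h \<in> carrier G" for h
    using that assms(1) by (auto simp: hom_def LieAutGroup_def lie_auto_def)
  show "\<phi> g \<in> lie_hom K L L" and "\<phi> g \<in> Bij (carrier L)"
    using *[OF assms(2)] by auto
  fix h x assume "h \<in> carrier G" "x \<in> carrier L"
  moreover from this have "\<phi> (g \<otimes>\<^bsub>G\<^esub> h) = compose (carrier L) (\<phi> g) (\<phi> h)"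
    using * assms by (simp add: hom_def LieAutGroup_def BijGroup_def)
  ultimately show "\<phi> (g \<otimes>\<^bsub>G\<^esub> h) x = \<phi> g (\<phi> h x)"
    by (simp add: compose_eq)
qed

lemma lie_hom_zero:
  assumes "f \<in> lie_hom K L L"
  shows "f \<zero>\<^bsub>L\<^esub> = \<zero>\<^bsub>L\<^esub>"
proof -
  have "f (\<zero> \<odot>\<^bsub>L\<^esub> \<zero>\<^bsub>L\<^esub>) = \<zero> \<odot>\<^bsub>L\<^esub> f \<zero>\<^bsub>L\<^esub>"
    by (rule lie_homD(3)[OF assms]) auto
  then show ?thesis
    by (simp add: lie_homD(1)[OF assms])
qed

lemma lie_hom_finsum:
  assumes f: "f \<in> lie_hom K L L" and "finite A" "u \<in> A \<rightarrow> carrier L"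
  shows "f (\<Oplus>\<^bsub>L\<^esub>i\<in>A. u i) = (\<Oplus>\<^bsub>L\<^esub>i\<in>A. f (u i))"
  using assms(2,3)
proof (induction A rule: finite_induct)
  case empty
  then show ?case by (simp add: lie_hom_zero[OF f])
next
  case (insert a A)
  then have "u a \<in> carrier L" "u \<in> A \<rightarrow> carrier L" by auto
  moreover from this have "(\<lambda>i. f (u i)) \<in> A \<rightarrow> carrier L" "f (u a) \<in> carrier L"
    using lie_homD(1)[OF f] by auto
  ultimately show ?case
    using insert by (simp add: M.finsum_insert lie_homD(2)[OF f])
qed

lemma lie_algebra_invariants:
  assumes "\<phi> \<in> hom G (LieAutGroup K L)"
  shows "lie_algebra K (lie_invariants L G \<phi>)"
proof -
  note H = lie_homD[OF lie_action(1)[OF assms]]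
  have neg: "\<exists>y. y \<in> carrier L \<and> (\<forall>g\<in>carrier G. \<phi> g y = y) \<and> x \<oplus>\<^bsub>L\<^esub> y = \<zero>\<^bsub>L\<^esub>"
    if x: "x \<in> carrier L" "\<forall>g\<in>carrier G. \<phi> g x = x" for x
  proof (intro exI conjI ballI)
    have e: "(\<ominus> \<one>) \<odot>\<^bsub>L\<^esub> x = \<ominus>\<^bsub>L\<^esub> x"
      using x smult_l_minus[of \<one> x] by simp
    show "(\<ominus> \<one>) \<odot>\<^bsub>L\<^esub> x \<in> carrier L" "x \<oplus>\<^bsub>L\<^esub> (\<ominus> \<one>) \<odot>\<^bsub>L\<^esub> x = \<zero>\<^bsub>L\<^esub>"
      using x by (simp_all add: e M.r_neg)
    fix g assume "g \<in> carrier G"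
    then show "\<phi> g ((\<ominus> \<one>) \<odot>\<^bsub>L\<^esub> x) = (\<ominus> \<one>) \<odot>\<^bsub>L\<^esub> x"
      using x by (simp add: H(3))
  qed
  have "abelian_group (lie_invariants L G \<phi>)"
    by (rule abelian_groupI)
      (auto simp: lie_invariants_def H(2) lie_hom_zero[OF lie_action(1)[OF assms]]
        M.a_ac neg)
  then have "module K (lie_invariants L G \<phi>)"
    by (rule moduleI[OF R.is_cring])
      (auto simp: lie_invariants_def H(3) smult_l_distr smult_r_distr smult_assoc1)
  then show ?thesis
    by (rule lie_algebra.intro, unfold_locales)
      (auto simp: lie_invariants_def H(4) bracket_add_left bracket_add_right bracket_smult_left
        bracket_smult_right bracket_self jacobi)
qed

lemma lie_trace_linear:
  assumes G: "group G" "finite (carrier G)" and \<phi>: "\<phi> \<in> hom G (LieAutGroup K L)"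
    and n: "[order G] \<cdot> \<one> \<in> Units K"
  shows "lie_trace K L G \<phi> \<in> hom (add_monoid L) (add_monoid (lie_invariants L G \<phi>))"
    and "\<And>a x. a \<in> carrier K \<Longrightarrow> x \<in> carrier L \<Longrightarrow>
      lie_trace K L G \<phi> (a \<odot>\<^bsub>L\<^esub> x) = a \<odot>\<^bsub>L\<^esub> lie_trace K L G \<phi> x"
proof -
  interpret G: group G by (rule G)
  note A = lie_action[OF \<phi>]
  note H = lie_homD[OF A(1)]
  let ?s = "\<lambda>x. \<Oplus>\<^bsub>L\<^esub>g\<in>carrier G. \<phi> g x"
  let ?c = "inv ([order G] \<cdot> \<one>)"
  have c: "?c \<in> carrier K" using n by auto
  have s: "?s x \<in> carrier L" if "x \<in> carrier L" for x
    using that H(1) by (auto intro: M.finsum_closed)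
  have inv: "\<phi> h (?s x) = ?s x" if h: "h \<in> carrier G" and x: "x \<in> carrier L" for h x
  proof -
    have "\<phi> h (?s x) = (\<Oplus>\<^bsub>L\<^esub>g\<in>carrier G. \<phi> h (\<phi> g x))"
      using h x H(1) G by (intro lie_hom_finsum A(1)) auto
    also have "\<dots> = (\<Oplus>\<^bsub>L\<^esub>g\<in>carrier G. \<phi> (h \<otimes>\<^bsub>G\<^esub> g) x)"
      using h x H(1) by (intro M.finsum_cong') (auto simp: A(3))
    also have "\<dots> = (\<Oplus>\<^bsub>L\<^esub>g\<in>(\<lambda>g. h \<otimes>\<^bsub>G\<^esub> g) ` carrier G. \<phi> g x)"
      using h x H(1) by (subst M.finsum_reindex) (auto simp: inj_on_def)
    also have "(\<lambda>g. h \<otimes>\<^bsub>G\<^esub> g) ` carrier G = carrier G"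
      using G.surj_const_mult[OF h] .
    finally show ?thesis .
  qed
  show "lie_trace K L G \<phi> \<in> hom (add_monoid L) (add_monoid (lie_invariants L G \<phi>))"
  proof (rule homI)
    fix x assume "x \<in> carrier (add_monoid L)"
    then show "lie_trace K L G \<phi> x \<in> carrier (add_monoid (lie_invariants L G \<phi>))"
      using c s inv by (auto simp: lie_trace_def lie_invariants_def H(3))
  next
    fix x y assume "x \<in> carrier (add_monoid L)" "y \<in> carrier (add_monoid L)"
    then have xy: "x \<in> carrier L" "y \<in> carrier L" by auto
    have "?s (x \<oplus>\<^bsub>L\<^esub> y) = (\<Oplus>\<^bsub>L\<^esub>g\<in>carrier G. \<phi> g x \<oplus>\<^bsub>L\<^esub> \<phi> g y)"
      using xy H(1) by (intro M.finsum_cong') (auto simp: H(2))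
    also have "\<dots> = ?s x \<oplus>\<^bsub>L\<^esub> ?s y"
      using xy H(1) by (intro M.finsum_addf) auto
    finally show "lie_trace K L G \<phi> (x \<otimes>\<^bsub>add_monoid L\<^esub> y) =
      lie_trace K L G \<phi> x \<otimes>\<^bsub>add_monoid (lie_invariants L G \<phi>)\<^esub> lie_trace K L G \<phi> y"
      using xy c s by (simp add: lie_trace_def lie_invariants_def smult_r_distr)
  qed
  fix a x assume ax: "a \<in> carrier K" "x \<in> carrier L"
  have "?s (a \<odot>\<^bsub>L\<^esub> x) = (\<Oplus>\<^bsub>L\<^esub>g\<in>carrier G. a \<odot>\<^bsub>L\<^esub> \<phi> g x)"
    using ax H(1) by (intro M.finsum_cong') (auto simp: H(3))
  also have "\<dots> = a \<odot>\<^bsub>L\<^esub> ?s x"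
    using ax H(1) G by (subst finsum_smult_ldistr) auto
  finally show "lie_trace K L G \<phi> (a \<odot>\<^bsub>L\<^esub> x) = a \<odot>\<^bsub>L\<^esub> lie_trace K L G \<phi> x"
    using ax c s by (simp add: lie_trace_def smult_assoc1[symmetric] R.m_comm)
qed

end

end

theory Submission
  imports Defs
begin

text \<open>
  Let \<open>x\<close> have trace zero and let \<open>s i\<close> be the sum of the \<open>\<gamma>\<^sup>j \<triangleright> x\<close> over \<open>j < i\<close>, so that
  \<open>s 0 = s n = 0\<close> and \<open>s (i + 1) = \<gamma> \<triangleright> s i + x\<close>. Summing over \<open>i < n\<close>, the sum \<open>S\<close> of all
  \<open>s i\<close> satisfies \<open>S = \<gamma> \<triangleright> S + n x\<close>, and \<open>y = S / n\<close> satisfies \<open>y - \<gamma> \<triangleright> y = x\<close>.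
\<close>

context lie_algebra
begin

lemma finsum_lessThan_Suc:
  fixes u :: "nat \<Rightarrow> 'b"
  assumes "u \<in> UNIV \<rightarrow> carrier L"
  shows "(\<Oplus>\<^bsub>L\<^esub>i\<in>{..<Suc m}. u i) = u m \<oplus>\<^bsub>L\<^esub> (\<Oplus>\<^bsub>L\<^esub>i\<in>{..<m}. u i)"
  using assms by (auto simp: lessThan_Suc M.finsum_insert Pi_iff)

text \<open>Bridges the repeated sums produced by counting terms and the scalars of
  \<open>K\<close>, where the inverse of \<open>n\<close> is available to cancel them.\<close>

lemma smult_nat_mult_one:
  assumes "x \<in> carrier L"
  shows "([(m::nat)] \<cdot> \<one>) \<odot>\<^bsub>L\<^esub> x = [m] \<cdot>\<^bsub>L\<^esub> x"
  using assms by (induction m) (simp_all add: smult_l_distr)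

text \<open>The inclusion of the kernel, stated for a single endomorphism: it is applied with
  \<open>f\<close> the action of \<gamma> and \<open>n\<close> the order of \<gamma>, where the
  orbit sum is the trace before division by \<open>n\<close>.\<close>

lemma diff_eq_of_orbit_sum_zero:
  assumes f: "f \<in> lie_hom K L L" and x: "x \<in> carrier L"
    and n: "[(n::nat)] \<cdot> \<one> \<in> Units K"
    and sum: "(\<Oplus>\<^bsub>L\<^esub>i\<in>{..<n}. (f ^^ i) x) = \<zero>\<^bsub>L\<^esub>"
  shows "\<exists>y\<in>carrier L. y \<ominus>\<^bsub>L\<^esub> f y = x"
proof -
  note H = lie_homD[OF f]
  define s where "s i = (\<Oplus>\<^bsub>L\<^esub>j\<in>{..<i}. (f ^^ j) x)" for i
  define S where "S m = (\<Oplus>\<^bsub>L\<^esub>i\<in>{..<m}. s i)" for m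
  have pow [simp]: "(f ^^ i) x \<in> carrier L" for i
    by (induction i) (simp_all add: x H(1))
  have s [simp]: "s i \<in> carrier L" for i
    unfolding s_def by (auto intro: M.finsum_closed)
  have S [simp]: "S i \<in> carrier L" for i
    unfolding S_def by (auto intro: M.finsum_closed)
  have s_Suc: "s (Suc i) = (f ^^ i) x \<oplus>\<^bsub>L\<^esub> s i" for i
    unfolding s_def by (rule finsum_lessThan_Suc) simp
  have S_Suc: "S (Suc i) = s i \<oplus>\<^bsub>L\<^esub> S i" for i
    unfolding S_def by (rule finsum_lessThan_Suc) simp
  have s_0: "s 0 = \<zero>\<^bsub>L\<^esub>" and S_0: "S 0 = \<zero>\<^bsub>L\<^esub>"
    by (simp_all add: s_def S_def)
  \<comment> \<open>\<open>s_Suc\<close> splits off the highest power of \<open>f\<close>; this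
    splits off the lowest one, \<open>x\<close> itself, since \<open>f\<close> shifts the remaining
    terms by one.\<close>
  have step: "s (Suc i) = f (s i) \<oplus>\<^bsub>L\<^esub> x" for i
  proof (induction i)
    case 0
    then show ?case by (simp add: s_Suc s_0 lie_hom_zero[OF f] x)
  next
    case (Suc i)
    have "s (Suc (Suc i)) = f ((f ^^ i) x) \<oplus>\<^bsub>L\<^esub> (f (s i) \<oplus>\<^bsub>L\<^esub> x)"
      using Suc s_Suc[of "Suc i"] by simp
    also have "\<dots> = f (s (Suc i)) \<oplus>\<^bsub>L\<^esub> x"
      by (simp add: s_Suc H x M.a_assoc)
    finally show ?case .
  qed
  \<comment> \<open>This is \<open>step\<close> summed over \<open>i < m\<close>: as
    \<open>s 0\<close> vanishes, the shifted sums add up to \<open>S (Suc m)\<close>, which is the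
    left-hand side. At \<open>m = n\<close> the term \<open>s m\<close> drops out.\<close>
  have total: "S m \<oplus>\<^bsub>L\<^esub> s m = f (S m) \<oplus>\<^bsub>L\<^esub> [m] \<cdot>\<^bsub>L\<^esub> x" for m
  proof (induction m)
    case 0
    then show ?case by (simp add: s_0 S_0 lie_hom_zero[OF f])
  next
    case (Suc m)
    have "S (Suc m) \<oplus>\<^bsub>L\<^esub> s (Suc m) = (S m \<oplus>\<^bsub>L\<^esub> s m) \<oplus>\<^bsub>L\<^esub> (f (s m) \<oplus>\<^bsub>L\<^esub> x)"
      by (simp add: S_Suc step H x M.a_ac)
    also have "\<dots> = (f (S m) \<oplus>\<^bsub>L\<^esub> [m] \<cdot>\<^bsub>L\<^esub> x) \<oplus>\<^bsub>L\<^esub> (f (s m) \<oplus>\<^bsub>L\<^esub> x)"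
      by (simp only: Suc)
    also have "\<dots> = f (S (Suc m)) \<oplus>\<^bsub>L\<^esub> [Suc m] \<cdot>\<^bsub>L\<^esub> x"
      by (simp add: S_Suc H x M.a_ac)
    finally show ?case .
  qed
  \<comment> \<open>\<open>c\<close> is \<open>1/n\<close>, so the witness below is the average of
    the partial sums \<open>s i\<close> over \<open>i < n\<close>.\<close>
  define c where "c = inv ([n] \<cdot> \<one>)"
  have c: "c \<in> carrier K" "c \<otimes> ([n] \<cdot> \<one>) = \<one>"
    using n by (simp_all add: c_def)
  have "s n = \<zero>\<^bsub>L\<^esub>"
    using sum by (simp add: s_def)
  then have "S n = f (S n) \<oplus>\<^bsub>L\<^esub> [n] \<cdot>\<^bsub>L\<^esub> x"
    using total[of n] by simp
  then have "c \<odot>\<^bsub>L\<^esub> S n = c \<odot>\<^bsub>L\<^esub> (f (S n) \<oplus>\<^bsub>L\<^esub> ([n] \<cdot> \<one>) \<odot>\<^bsub>L\<^esub> x)"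
    by (simp add: smult_nat_mult_one x)
  also have "\<dots> = f (c \<odot>\<^bsub>L\<^esub> S n) \<oplus>\<^bsub>L\<^esub> (c \<otimes> ([n] \<cdot> \<one>)) \<odot>\<^bsub>L\<^esub> x"
    using c(1) x by (simp add: smult_r_distr smult_assoc1 H)
  also have "\<dots> = x \<oplus>\<^bsub>L\<^esub> f (c \<odot>\<^bsub>L\<^esub> S n)"
    using c x by (simp add: H M.a_comm)
  finally have "c \<odot>\<^bsub>L\<^esub> S n \<ominus>\<^bsub>L\<^esub> f (c \<odot>\<^bsub>L\<^esub> S n) = x"
    using c(1) x by (metis H(1) M.add.inv_solve_right M.minus_eq S smult_closed)
  then show ?thesis
    using c(1) by (intro bexI[of _ "c \<odot>\<^bsub>L\<^esub> S n"]) simp_all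
qed

lemma lie_action_one:
  assumes "group G" and \<phi>: "\<phi> \<in> hom G (LieAutGroup K L)" and "x \<in> carrier L"
  shows "\<phi> \<one>\<^bsub>G\<^esub> x = x"
proof -
  have "\<phi> \<one>\<^bsub>G\<^esub> = \<one>\<^bsub>LieAutGroup K L\<^esub>"
    by (rule hom_one[OF \<phi> assms(1) group_LieAutGroup])
  then show ?thesis
    using assms(3) by (simp add: LieAutGroup_def BijGroup_def)
qed

lemma lie_action_pow:
  assumes G: "group G" and \<phi>: "\<phi> \<in> hom G (LieAutGroup K L)"
    and g: "g \<in> carrier G" and x: "x \<in> carrier L"
  shows "\<phi> (g [^]\<^bsub>G\<^esub> (i::nat)) x = (\<phi> g ^^ i) x"
proof -
  interpret G: group G by (rule G)
  show ?thesis
  proof (induction i)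
    case 0
    show ?case using lie_action_one[OF G \<phi> x] by simp
  next
    case (Suc i)
    \<comment> \<open>\<open>nat_pow_Suc2\<close> puts the extra factor on the left, matching the
      outermost application in the iterate.\<close>
    then show ?case
      using g x by (simp only: G.nat_pow_Suc2 G.nat_pow_closed lie_action(3)[OF \<phi>]) simp
  qed
qed

text \<open>Right translation by \<open>h\<close> permutes the group, so it only reorders the sum.
  Hence \<open>y\<close> and its translate have equal traces, which puts their difference in the
  kernel.\<close>

lemma lie_trace_action:
  assumes G: "group G" and \<phi>: "\<phi> \<in> hom G (LieAutGroup K L)"
    and h: "h \<in> carrier G" and x: "x \<in> carrier L"
  shows "lie_trace K L G \<phi> (\<phi> h x) = lie_trace K L G \<phi> x"
proof -
  interpret G: group G by (rule G)
  note A = lie_action[OF \<phi>]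
  note H = lie_homD[OF A(1)]
  have inj: "inj_on (\<lambda>g. g \<otimes>\<^bsub>G\<^esub> h) (carrier G)"
    using h by (auto simp: inj_on_def)
  have surj: "(\<lambda>g. g \<otimes>\<^bsub>G\<^esub> h) ` carrier G = carrier G"
  proof
    show "carrier G \<subseteq> (\<lambda>g. g \<otimes>\<^bsub>G\<^esub> h) ` carrier G"
    proof
      fix g assume "g \<in> carrier G"
      then show "g \<in> (\<lambda>g. g \<otimes>\<^bsub>G\<^esub> h) ` carrier G"
        using h by (intro image_eqI[of _ _ "g \<otimes>\<^bsub>G\<^esub> inv\<^bsub>G\<^esub> h"]) (simp_all add: G.m_assoc)
    qed
  qed (use h in auto)
  have "(\<Oplus>\<^bsub>L\<^esub>g\<in>carrier G. \<phi> g (\<phi> h x)) = (\<Oplus>\<^bsub>L\<^esub>g\<in>carrier G. \<phi> (g \<otimes>\<^bsub>G\<^esub> h) x)"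
    using h x H(1) by (intro M.finsum_cong') (auto simp: A(3))
  also have "\<dots> = (\<Oplus>\<^bsub>L\<^esub>g\<in>(\<lambda>g. g \<otimes>\<^bsub>G\<^esub> h) ` carrier G. \<phi> g x)"
    using h x H(1) inj by (subst M.finsum_reindex) auto
  finally have "(\<Oplus>\<^bsub>L\<^esub>g\<in>carrier G. \<phi> g (\<phi> h x)) = (\<Oplus>\<^bsub>L\<^esub>g\<in>carrier G. \<phi> g x)"
    by (simp only: surj)
  then show ?thesis
    using x H(1)[OF h] by (simp add: lie_trace_def)
qed

lemma lie_trace_eq_zero_iff:
  assumes \<phi>: "\<phi> \<in> hom G (LieAutGroup K L)"
    and n: "[order G] \<cdot> \<one> \<in> Units K" and x: "x \<in> carrier L"
  shows "lie_trace K L G \<phi> x = \<zero>\<^bsub>L\<^esub> \<longleftrightarrow> (\<Oplus>\<^bsub>L\<^esub>g\<in>carrier G. \<phi> g x) = \<zero>\<^bsub>L\<^esub>"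
    (is "_ \<longleftrightarrow> ?s = _")
proof -
  let ?m = "[order G] \<cdot> \<one>"
  have s: "?s \<in> carrier L"
    using x lie_homD(1)[OF lie_action(1)[OF \<phi>]] by (auto intro: M.finsum_closed)
  have "?m \<odot>\<^bsub>L\<^esub> (inv ?m \<odot>\<^bsub>L\<^esub> ?s) = ?s"
    using n s by (simp add: smult_assoc1[symmetric])
  then have "inv ?m \<odot>\<^bsub>L\<^esub> ?s = \<zero>\<^bsub>L\<^esub> \<longleftrightarrow> ?s = \<zero>\<^bsub>L\<^esub>"
    using n by (metis R.Units_closed R.Units_inv_closed smult_r_null)
  then show ?thesis
    using x by (simp add: lie_trace_def)
qed

end

text \<open>In a finite group natural exponents already exhaust the subgroup generated by
  \<open>a\<close>; those below the order suffice and give distinct powers.\<close>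

lemma (in group) bij_betw_pow_cyclic:
  assumes fin: "finite (carrier G)" and a: "a \<in> carrier G" and gen: "generate G {a} = carrier G"
  shows "bij_betw (\<lambda>i::nat. a [^] i) {..<ord a} (carrier G)"
proof -
  have ord: "ord a \<ge> 1" by (rule ord_ge_1[OF fin a])
  \<comment> \<open>Positivity of the order matters: with truncated subtraction the two intervals
    would differ at order 0.\<close>
  then have I: "{..<ord a} = {0..ord a - 1}" by auto
  have "carrier G = {a [^] i |i. i \<in> (UNIV::nat set)}"
    using generate_pow_on_finite_carrier[OF fin a] gen by auto
  then have "(\<lambda>i::nat. a [^] i) ` {..<ord a} = carrier G"
    unfolding I using ord_elems[OF fin a] by auto
  then show ?thesis
    unfolding bij_betw_def using ord_inj[OF a] I by simp
qed

theorem theorem3p12: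
  fixes K :: "('a, 'm) ring_scheme"
    and L :: "('a, 'b, 'n) lie_algebra_scheme"
    and G :: "('g, 'p) monoid_scheme"
    and \<gamma> :: 'g
    and \<phi> :: "'g \<Rightarrow> 'b \<Rightarrow> 'b"
  assumes "field K"
    and "group G" and "finite (carrier G)"
    and "\<gamma> \<in> carrier G" and "generate G {\<gamma>} = carrier G"
    and "[group.ord G \<gamma>] \<cdot>\<^bsub>K\<^esub> \<one>\<^bsub>K\<^esub> \<in> Units K"
    and "lie_algebra K L"
    and "\<phi> \<in> hom G (LieAutGroup K L)"
  shows "a_kernel L (lie_invariants L G \<phi>) (lie_trace K L G \<phi>)
    = {y \<ominus>\<^bsub>L\<^esub> \<phi> \<gamma> y | y. y \<in> carrier L}"
proof -
  interpret G: group G by (rule assms(2))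
  interpret lie_algebra K L by (rule assms(7))
  note \<phi> = assms(8) and \<gamma> = assms(4)
  let ?t = "lie_trace K L G \<phi>"
  note f = lie_action(1)[OF \<phi> \<gamma>]
  note H = lie_homD[OF f]
  have bij: "bij_betw (\<lambda>i::nat. \<gamma> [^]\<^bsub>G\<^esub> i) {..<G.ord \<gamma>} (carrier G)"
    by (rule G.bij_betw_pow_cyclic[OF assms(3-5)])
  \<comment> \<open>The trace divides by the order of the group, whereas the invertibility
    hypothesis concerns the order of the generator.\<close>
  then have "order G = G.ord \<gamma>"
    by (metis bij_betw_same_card card_lessThan order_def)
  then have n: "[order G] \<cdot>\<^bsub>K\<^esub> \<one>\<^bsub>K\<^esub> \<in> Units K"
    using assms(6) by simp
  have t: "?t (x \<oplus>\<^bsub>L\<^esub> y) = ?t x \<oplus>\<^bsub>L\<^esub> ?t y" "?t x \<in> carrier L"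
    if "x \<in> carrier L" "y \<in> carrier L" for x y
    using lie_trace_linear(1)[OF assms(2,3) \<phi> n] that
    by (auto simp: hom_def lie_invariants_def)
  have sum: "(\<Oplus>\<^bsub>L\<^esub>g\<in>carrier G. \<phi> g x) = (\<Oplus>\<^bsub>L\<^esub>i\<in>{..<G.ord \<gamma>}. (\<phi> \<gamma> ^^ i) x)"
    if x: "x \<in> carrier L" for x
  proof -
    have "(\<Oplus>\<^bsub>L\<^esub>g\<in>carrier G. \<phi> g x) = (\<Oplus>\<^bsub>L\<^esub>i\<in>{..<G.ord \<gamma>}. \<phi> (\<gamma> [^]\<^bsub>G\<^esub> i) x)"
      using bij x \<gamma> lie_homD(1)[OF lie_action(1)[OF \<phi>]]
      by (subst M.finsum_reindex[symmetric]) (auto simp: bij_betw_def)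
    then show ?thesis
      by (simp only: lie_action_pow[OF assms(2) \<phi> \<gamma> x])
  qed
  \<comment> \<open>The invariants differ from \<open>L\<close> only in the carrier, so both have
    the same zero.\<close>
  have ker: "a_kernel L (lie_invariants L G \<phi>) ?t = {x \<in> carrier L. ?t x = \<zero>\<^bsub>L\<^esub>}"
    by (simp add: a_kernel_def kernel_def lie_invariants_def)
  show ?thesis
    unfolding ker
  proof (intro Set.set_eqI iffI)
    fix x assume "x \<in> {x \<in> carrier L. ?t x = \<zero>\<^bsub>L\<^esub>}"
    then have x: "x \<in> carrier L" and "?t x = \<zero>\<^bsub>L\<^esub>" by auto
    then have "(\<Oplus>\<^bsub>L\<^esub>i\<in>{..<G.ord \<gamma>}. (\<phi> \<gamma> ^^ i) x) = \<zero>\<^bsub>L\<^esub>"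
      using lie_trace_eq_zero_iff[OF \<phi> n x] sum[OF x] by simp
    then show "x \<in> {y \<ominus>\<^bsub>L\<^esub> \<phi> \<gamma> y | y. y \<in> carrier L}"
      using diff_eq_of_orbit_sum_zero[OF f x assms(6)] by auto
  next
    fix x assume "x \<in> {y \<ominus>\<^bsub>L\<^esub> \<phi> \<gamma> y | y. y \<in> carrier L}"
    then obtain y where y: "y \<in> carrier L" and x: "x = y \<ominus>\<^bsub>L\<^esub> \<phi> \<gamma> y" by auto
    have xc: "x \<in> carrier L" using x y by (simp add: H(1))
    \<comment> \<open>In this form additivity of the trace is enough: the traces of \<open>y\<close>
      and of its translate agree and cancel, leaving trace zero for \<open>x\<close>.\<close>
    have "y = x \<oplus>\<^bsub>L\<^esub> \<phi> \<gamma> y"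
      using x y by (simp add: H(1) M.minus_eq M.a_assoc M.l_neg)
    then have "?t y = ?t x \<oplus>\<^bsub>L\<^esub> ?t (\<phi> \<gamma> y)"
      using t(1)[OF xc H(1)[OF y]] by simp
    then have "?t y = ?t x \<oplus>\<^bsub>L\<^esub> ?t y"
      by (simp add: lie_trace_action[OF assms(2) \<phi> \<gamma> y])
    then show "x \<in> {x \<in> carrier L. ?t x = \<zero>\<^bsub>L\<^esub>}"
      using xc y t(2) by (metis (mono_tags, lifting) M.add.r_cancel_one' mem_Collect_eq)
  qed
qed

end
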